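(* If $D$ is an integral domain such that the power series ring $D[[X]]$ is a $v$-domain, then $D$ is a $v$-domain.
   Context: For an integral domain $R$ with quotient field $K$ and a nonzero fractional ideal $I$ of $R$, put $I^{-1}=\{x\in K\mid xI\subseteq R\}$ and $I_v=(I^{-1})^{-1}$. $R$ is a $v$-domain if $(II^{-1})_v=R$ for every nonzero finitely generated ideal $I$ of $R$. *)

theory Defs
  imports "HOL-Computational_Algebra.Computational_Algebra"
begin

text \<open>
  The quotient field of a domain \<^typ>\<open>'a::idom\<close> is \<^typ>\<open>'a fract\<close>, and
  the domain is identified with its image \<^term>\<open>range to_fract\<close> there. Below,
  \<open>subspace\<close> means a submodule of the quotient field over the domain, and
  \<open>span\<close> the submodule generated by a set.
\<close>

global_interpretation fract_module: module "\<lambda>(r::'a::idom) (x::'a fract). to_fract r * x"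
  by standard (simp_all add: algebra_simps)

definition integral_ideal :: "'a::idom fract set \<Rightarrow> bool" where
  "integral_ideal I \<longleftrightarrow> fract_module.subspace I \<and> I \<subseteq> range to_fract"

definition fin_gen_ideal :: "'a::idom fract set \<Rightarrow> bool" where
  "fin_gen_ideal I \<longleftrightarrow> integral_ideal I \<and> (\<exists>A. finite A \<and> I = fract_module.span A)"

definition ideal_mult :: "'a::idom fract set \<Rightarrow> 'a fract set \<Rightarrow> 'a fract set" where
  "ideal_mult I J = fract_module.span {x * y | x y. x \<in> I \<and> y \<in> J}"

text \<open>
  The next two operations are total on subsets of the quotient field. They are only applied to
  nonzero fractional ideals: if \<open>I\<close> is a nonzero ideal of the domain, then
  \<open>I\<close>, its inverse and their product are of this kind.
\<close>

definition ideal_inverse :: "'a::idom fract set \<Rightarrow> 'a fract set" where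
  "ideal_inverse I = {x. \<forall>y\<in>I. x * y \<in> range to_fract}"

definition v_closure :: "'a::idom fract set \<Rightarrow> 'a fract set" where
  "v_closure I = ideal_inverse (ideal_inverse I)"

definition v_domain :: "'a::idom itself \<Rightarrow> bool" where
  "v_domain _ \<longleftrightarrow>
     (\<forall>I :: 'a fract set. fin_gen_ideal I \<and> I \<noteq> {0} \<longrightarrow>
        v_closure (ideal_mult I (ideal_inverse I)) = range to_fract)"

end

theory Submission
  imports Defs
begin

text \<open>
  Inverting twice shows that \<open>D\<close> is a \<open>v\<close>-domain iff every \<open>x\<close> in the quotient field with
  \<open>x I\<^sup>-\<^sup>1 \<subseteq> I\<^sup>-\<^sup>1\<close> for some nonzero finitely generated ideal \<open>I\<close> lies in \<open>D\<close>. The inverse of the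
  extension of \<open>I\<close> to \<open>D[[X]]\<close> is \<open>I\<^sup>-\<^sup>1[[X]]\<close>, so such an \<open>x\<close> also stabilises the inverse
  of the extended ideal. If \<open>D[[X]]\<close> is a \<open>v\<close>-domain, then \<open>x\<close> is a power series over \<open>D\<close>,
  and comparing constant coefficients gives \<open>x \<in> D\<close>.
\<close>

lemma ideal_inverse_antimono: "I \<subseteq> J \<Longrightarrow> ideal_inverse J \<subseteq> ideal_inverse I"
  by (auto simp: ideal_inverse_def)

lemma subset_v_closure: "I \<subseteq> v_closure I"
  by (auto simp: v_closure_def ideal_inverse_def mult.commute)

text \<open>Inverting \<open>I \<subseteq> v_closure I\<close> reverses the inclusion; the other
  inclusion is the same fact applied to \<open>ideal_inverse I\<close>, since both sides then agree
  with threefold inversion.\<close>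

lemma ideal_inverse_v_closure: "ideal_inverse (v_closure I) = ideal_inverse I"
  using ideal_inverse_antimono[OF subset_v_closure[of I]] subset_v_closure[of "ideal_inverse I"]
  by (auto simp: v_closure_def)

lemma range_to_fract_mult:
  "x \<in> range to_fract \<Longrightarrow> y \<in> range to_fract \<Longrightarrow> x * y \<in> range to_fract"
  by (auto simp flip: to_fract_mult)

lemma range_to_fract_add:
  "x \<in> range to_fract \<Longrightarrow> y \<in> range to_fract \<Longrightarrow> x + y \<in> range to_fract"
  by (auto simp flip: to_fract_add)

lemma ideal_inverse_range_to_fract: "ideal_inverse (range to_fract) = range to_fract"
proof
  show "ideal_inverse (range to_fract) \<subseteq> (range to_fract :: 'a fract set)"
  proof
    fix x :: "'a fract" assume "x \<in> ideal_inverse (range to_fract)"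
    then have "x * to_fract 1 \<in> range to_fract"
      unfolding ideal_inverse_def by blast
    then show "x \<in> range to_fract" by simp
  qed
  show "range to_fract \<subseteq> (ideal_inverse (range to_fract) :: 'a fract set)"
    unfolding ideal_inverse_def using range_to_fract_mult by blast
qed

text \<open>The ring is its own inverse and threefold inversion equals a single one, so inverting
  either equation yields the other.\<close>

lemma v_closure_eq_range_to_fract_iff:
  "v_closure I = range to_fract \<longleftrightarrow> ideal_inverse I = range to_fract"
  by (metis ideal_inverse_range_to_fract ideal_inverse_v_closure v_closure_def)

text \<open>For fixed \<open>x\<close>, the elements that \<open>x\<close> multiplies into the ring
  form a submodule, so it suffices to test generators.\<close>

lemma ideal_inverse_span: "ideal_inverse (fract_module.span A) = ideal_inverse A"
proof
  show "ideal_inverse (fract_module.span A) \<subseteq> ideal_inverse A"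
    by (intro ideal_inverse_antimono fract_module.span_superset)
  show "ideal_inverse A \<subseteq> ideal_inverse (fract_module.span A)"
  proof
    fix x :: "'a fract" assume x: "x \<in> ideal_inverse A"
    have "fract_module.subspace {y. x * y \<in> range to_fract}"
      unfolding fract_module.subspace_def
      using rangeI[of to_fract "0 :: 'a"]
      by (auto simp: distrib_left mult.left_commute[of x]
          intro: range_to_fract_add range_to_fract_mult)
    then have "fract_module.span A \<subseteq> {y. x * y \<in> range to_fract}"
      using x by (intro fract_module.span_minimal) (auto simp: ideal_inverse_def)
    then show "x \<in> ideal_inverse (fract_module.span A)"
      by (auto simp: ideal_inverse_def)
  qed
qed

text \<open>Regrouping products identifies this inverse with a colon module; for
  \<open>J = ideal_inverse I\<close> it is the stabiliser of the inverse of
  \<open>I\<close>.\<close>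

lemma ideal_inverse_ideal_mult:
  fixes I J :: "'a::idom fract set"
  shows "ideal_inverse (ideal_mult I J) = {x. \<forall>z\<in>J. x * z \<in> ideal_inverse I}"
proof -
  have assoc: "x * z * y = x * (y * z)" for x y z :: "'a fract"
    by (simp only: mult_ac)
  have "ideal_inverse {y * z | y z. y \<in> I \<and> z \<in> J}
      = {x. \<forall>z\<in>J. \<forall>y\<in>I. x * (y * z) \<in> range to_fract}"
    unfolding ideal_inverse_def by blast
  then show ?thesis
    unfolding ideal_mult_def ideal_inverse_span
    by (simp only: ideal_inverse_def[of I] mem_Collect_eq assoc)
qed

lemma range_to_fract_subset_stabiliser:
  "range to_fract \<subseteq> {x. \<forall>y\<in>ideal_inverse I. x * y \<in> ideal_inverse I}"
proof clarify
  fix r y assume "y \<in> ideal_inverse I"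
  then show "to_fract r * y \<in> ideal_inverse I"
    using range_to_fract_mult[OF rangeI[of to_fract r]]
    unfolding ideal_inverse_def mem_Collect_eq mult.assoc by blast
qed

lemma fin_gen_ideal_iff:
  "fin_gen_ideal I \<longleftrightarrow> (\<exists>A. finite A \<and> I = fract_module.span (to_fract ` A))"
proof
  assume "fin_gen_ideal I"
  then obtain B where "finite B" "I = fract_module.span B" "I \<subseteq> range to_fract"
    by (auto simp: fin_gen_ideal_def integral_ideal_def)
  moreover from this have "B \<subseteq> range to_fract"
    using fract_module.span_superset[of B] by blast
  ultimately show "\<exists>A. finite A \<and> I = fract_module.span (to_fract ` A)"
    by (metis finite_subset_image)
next
  assume "\<exists>A. finite A \<and> I = fract_module.span (to_fract ` A)"
  moreover have "fract_module.subspace (range to_fract :: 'a fract set)"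
    unfolding fract_module.subspace_def
    by (metis rangeI range_to_fract_add range_to_fract_mult to_fract_0)
  ultimately show "fin_gen_ideal I"
    unfolding fin_gen_ideal_def integral_ideal_def
    by (metis finite_imageI fract_module.span_minimal fract_module.subspace_span image_mono
        subset_UNIV)
qed

text \<open>The stabiliser always contains the ring, so only one inclusion remains. Generators are
  taken in the ring itself, ready for divisibility arguments.\<close>

lemma v_domain_iff:
  "v_domain TYPE('a::idom) \<longleftrightarrow>
    (\<forall>A :: 'a set. finite A \<and> \<not> A \<subseteq> {0} \<longrightarrow>
      {x. \<forall>y\<in>ideal_inverse (to_fract ` A). x * y \<in> ideal_inverse (to_fract ` A)}
        \<subseteq> range to_fract)"
proof -
  have span_eq: "fract_module.span (to_fract ` A) = {0} \<longleftrightarrow> A \<subseteq> {0}" for A :: "'a set"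
  proof
    assume "fract_module.span (to_fract ` A) = {0}"
    then show "A \<subseteq> {0}"
      using fract_module.span_superset[of "to_fract ` A"] by auto
  next
    assume "A \<subseteq> {0}"
    then have "to_fract ` A \<subseteq> {0}" by auto
    then show "fract_module.span (to_fract ` A) = {0}"
      using fract_module.span_minimal[OF _ fract_module.subspace_single_0]
        fract_module.span_zero[of "to_fract ` A"] by (intro equalityI) simp_all
  qed
  have "v_domain TYPE('a) \<longleftrightarrow>
    (\<forall>A :: 'a set. finite A \<and> fract_module.span (to_fract ` A) \<noteq> {0} \<longrightarrow>
      v_closure (ideal_mult (fract_module.span (to_fract ` A))
        (ideal_inverse (fract_module.span (to_fract ` A)))) = range to_fract)"
    unfolding v_domain_def fin_gen_ideal_iff by blast
  also have "\<dots> \<longleftrightarrow> (\<forall>A :: 'a set. finite A \<and> \<not> A \<subseteq> {0} \<longrightarrow>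
      {x. \<forall>y\<in>ideal_inverse (to_fract ` A). x * y \<in> ideal_inverse (to_fract ` A)}
        = range to_fract)"
    by (simp only: v_closure_eq_range_to_fract_iff ideal_inverse_ideal_mult ideal_inverse_span
        span_eq)
  finally show ?thesis
    by (simp only: set_eq_subset range_to_fract_subset_stabiliser simp_thms)
qed

lemma fract_cases_to_fract:
  fixes x :: "'a::idom fract"
  obtains p q where "q \<noteq> 0" "x = to_fract p / to_fract q"
  by (metis Fract_cases Fract_conv_to_fract)

text \<open>Clearing the denominator turns membership into divisibility in the ring, which for power
  series can be checked on coefficients.\<close>

lemma quotient_in_ideal_inverse_iff:
  fixes q :: "'a::idom"
  assumes "q \<noteq> 0"
  shows "to_fract p / to_fract q \<in> ideal_inverse (to_fract ` A) \<longleftrightarrow> (\<forall>a\<in>A. q dvd p * a)"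
proof -
  have "to_fract p / to_fract q * to_fract a = to_fract d \<longleftrightarrow> p * a = q * d" for a d
  proof -
    have "to_fract p / to_fract q * to_fract a = to_fract d \<longleftrightarrow>
        to_fract (p * a) = to_fract (q * d)"
      using assms by (simp add: field_simps)
    then show ?thesis by (simp only: to_fract_eq_iff)
  qed
  then show ?thesis
    by (auto simp: ideal_inverse_def dvd_def image_iff)
qed

lemma quotient_in_range_to_fract_iff:
  fixes q :: "'a::idom"
  assumes "q \<noteq> 0"
  shows "to_fract p / to_fract q \<in> range to_fract \<longleftrightarrow> q dvd p"
  \<comment> \<open>The inverse of \<open>{1}\<close> is the ring.\<close>
  using quotient_in_ideal_inverse_iff[OF assms, of p "{1}"]
  by (simp add: ideal_inverse_def)

text \<open>Quotients chosen coefficient by coefficient assemble into a power series.\<close>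

lemma fps_const_dvd_iff:
  fixes f :: "'a::idom fps"
  shows "fps_const c dvd f \<longleftrightarrow> (\<forall>n. c dvd fps_nth f n)"
proof
  assume "\<forall>n. c dvd fps_nth f n"
  then obtain g where "fps_nth f n = c * g n" for n
    unfolding dvd_def by metis
  then have "f = fps_const c * Abs_fps g"
    by (simp add: fps_eq_iff)
  then show "fps_const c dvd f" by simp
qed (auto elim!: dvdE)

theorem proposition1p2:
  assumes "v_domain TYPE('a::idom fps)"
  shows "v_domain TYPE('a)"
  unfolding v_domain_iff
proof (intro allI impI subsetI, elim conjE)
  fix A :: "'a set" and x :: "'a fract"
  assume A: "finite A" "\<not> A \<subseteq> {0}"
    and "x \<in> {x. \<forall>y\<in>ideal_inverse (to_fract ` A). x * y \<in> ideal_inverse (to_fract ` A)}"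
  then have x: "x * y \<in> ideal_inverse (to_fract ` A)" if "y \<in> ideal_inverse (to_fract ` A)" for y
    using that by blast
  obtain p q where q: "q \<noteq> 0" and x_eq: "x = to_fract p / to_fract q"
    by (rule fract_cases_to_fract)
  obtain a where a: "a \<in> A" "a \<noteq> 0" using A by blast
  \<comment> \<open>The stability of the inverse under \<open>x = p / q\<close>, applied to its
    element \<open>r / a\<close> and freed of denominators.\<close>
  have stable: "q * a dvd p * r * b" if r: "\<forall>b\<in>A. a dvd r * b" and b: "b \<in> A" for r b
  proof -
    have "to_fract r / to_fract a \<in> ideal_inverse (to_fract ` A)"
      using r a by (simp add: quotient_in_ideal_inverse_iff)
    from x[OF this] have "to_fract (p * r) / to_fract (q * a) \<in> ideal_inverse (to_fract ` A)"
      by (simp add: x_eq)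
    then show ?thesis
      using q a b by (subst (asm) quotient_in_ideal_inverse_iff) auto
  qed
  let ?B = "fps_const ` A"
  have "to_fract (fps_const p) / to_fract (fps_const q) * y \<in> ideal_inverse (to_fract ` ?B)"
    if y: "y \<in> ideal_inverse (to_fract ` ?B)" for y
  proof -
    \<comment> \<open>As \<open>a\<close> is a generator, \<open>y\<close> times \<open>a\<close> is
      a power series; thus \<open>y\<close> has a constant denominator, and the conditions on it
      split into conditions on the coefficients of \<open>f\<close>.\<close>
    obtain f where f: "y * to_fract (fps_const a) = to_fract f"
      using y a by (auto simp: ideal_inverse_def)
    then have y_eq: "y = to_fract f / to_fract (fps_const a)"
      using a by (simp add: field_simps)
    have "\<forall>b\<in>A. fps_const a dvd f * fps_const b"
      using y a unfolding y_eq by (subst (asm) quotient_in_ideal_inverse_iff) auto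
    then have "\<forall>b\<in>A. a dvd fps_nth f n * b" for n
      by (simp add: fps_const_dvd_iff)
    \<comment> \<open>In each degree \<open>n\<close> this is \<open>stable\<close> with
      \<open>r\<close> the coefficient of \<open>f\<close> at \<open>n\<close>.\<close>
    then have "\<forall>b\<in>A. fps_const (q * a) dvd fps_const p * f * fps_const b"
      unfolding fps_const_dvd_iff by (simp add: stable)
    then have "to_fract (fps_const p * f) / to_fract (fps_const (q * a))
        \<in> ideal_inverse (to_fract ` ?B)"
      using q a by (subst quotient_in_ideal_inverse_iff) auto
    then show ?thesis
      by (simp add: y_eq flip: fps_const_mult)
  qed
  moreover have "finite ?B" "\<not> ?B \<subseteq> {0}"
    using A by auto
  ultimately have "to_fract (fps_const p) / to_fract (fps_const q) \<in> range to_fract"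
    using assms unfolding v_domain_iff by blast
  then have "fps_const q dvd fps_const p"
    using q by (subst (asm) quotient_in_range_to_fract_iff) auto
  then have "q dvd p"
    by (metis fps_const_dvd_iff fps_nth_fps_const)
  then show "x \<in> range to_fract"
    using q by (simp add: x_eq quotient_in_range_to_fract_iff)
qed

end
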